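(* Let $p$ be any prime, $m$ a positive integer, $q=p^m$, $s>1$ a positive integer, and $a\in\mu_{q^2+q+1}=\{x\in\mathbb{F}_{q^3}: x^{q^2+q+1}=1\}$. Then $$f_6(X)=2X^{q^2}+(a+a^{q+q^2})X^q+\left(a^{1+q^2}+a^{q}\right)X+\mathrm{Tr}_m^{3m}(X)^s\in\mathbb{F}_{q^3}[X]$$ is a permutation polynomial of $\mathbb{F}_{q^3}$ if and only if $a\neq 1$ and $\gcd(s,q-1)=1$.
   Context: $\mathrm{Tr}_m^{3m}(X)=X+X^q+X^{q^2}$ is the relative trace from $\mathbb{F}_{q^3}$ to $\mathbb{F}_q$. A polynomial $f\in\mathbb{F}_{q^3}[X]$ is a permutation polynomial of $\mathbb{F}_{q^3}$ if $c\mapsto f(c)$ is a bijection of $\mathbb{F}_{q^3}$. *)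

theory Defs
  imports "HOL-Computational_Algebra.Computational_Algebra"
    "HOL-Library.Cardinality"
begin

(* The finite field with q^3 elements is modelled by an arbitrary type of classes
   finite and field; its cardinality is prescribed where the type is used. *)

definition roots_of_unity :: "nat \<Rightarrow> 'a::field set" where
  "roots_of_unity n = {x. x ^ n = 1}"

(* Relative trace from the field with q^3 elements to the field with q elements,
   as a polynomial. *)
definition trace_poly :: "nat \<Rightarrow> 'a::field poly" where
  "trace_poly q = monom 1 1 + monom 1 q + monom 1 (q ^ 2)"

definition permutation_poly :: "'a::{finite,field} poly \<Rightarrow> bool" where
  "permutation_poly f \<longleftrightarrow> bij (poly f)"

definition f6 :: "nat \<Rightarrow> nat \<Rightarrow> 'a::field \<Rightarrow> 'a poly" where
  "f6 q s a =
     monom 2 (q ^ 2)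
     + monom (a + a ^ (q + q ^ 2)) q
     + monom (a ^ (1 + q ^ 2) + a ^ q) 1
     + trace_poly q ^ s"

end

theory Submission
  imports Defs
begin

text \<open>
  Write \<open>x'\<close> for the \<open>q\<close>-th power of \<open>x\<close>, \<open>T\<close> for the trace of \<open>x\<close> and \<open>d = (a - 1)\<^sup>2 / a\<close>.
  Since \<open>a\<close> has norm 1, \<open>f\<^sub>6(x) = 2 T + d' x + d x' + T\<^sup>s\<close>, and with \<open>u = d'' (d + d' - d'')\<close> one has
  \<open>Tr (u f\<^sub>6(x)) = - N(d) T\<^sup>s\<close> in every characteristic. This rests on the relation
  \<open>e\<^sub>1\<^sup>2 - 4 e\<^sub>2 = e\<^sub>3\<close> between the elementary symmetric functions of the conjugates of \<open>d\<close>.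
  If \<open>a \<noteq> 1\<close> and \<open>s\<close> is prime to \<open>q - 1\<close>, then \<open>f\<^sub>6(x)\<close> therefore determines \<open>T\<close>, and the remaining
  linear map \<open>d' x + d x'\<close> is injective on the kernel of the trace. Conversely, if \<open>f\<^sub>6\<close> is
  surjective, then every trace is an \<open>s\<close>-th power of a trace, and with
  \<open>k = (q - 1) / gcd(s, q - 1)\<close> every element is a root of \<open>Tr\<^sup>k\<^sup>+\<^sup>1 - Tr\<close>, which has degree less than
  \<open>q\<^sup>3\<close> unless \<open>k = q - 1\<close>. For \<open>a = 1\<close> the value
  \<open>f\<^sub>6(x)\<close> depends on \<open>T\<close> only.
\<close>

section \<open>Finite fields: powers, root counts and the characteristic\<close>

lemma power_card_eq_self:
  fixes x :: "'a::{finite,field}"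
  shows "x ^ CARD('a) = x"
proof (cases "x = 0")
  case False
  let ?U = "UNIV - {0 :: 'a}"
  have img: "(*) x ` ?U = ?U"
  proof (intro equalityI subsetI)
    fix y assume "y \<in> ?U"
    with False show "y \<in> (*) x ` ?U"
      by (intro image_eqI[of _ _ "y / x"]) auto
  qed (use False in auto)
  have "\<Prod>?U = \<Prod>((*) x ` ?U)"
    by (simp only: img)
  also have "\<dots> = (\<Prod>y\<in>?U. x * y)"
    using False by (subst prod.reindex) (auto simp: inj_on_def)
  also have "\<dots> = x ^ card ?U * \<Prod>?U"
    by (simp add: prod.distrib)
  finally have "x ^ card ?U = 1"
    by simp
  moreover have "CARD('a) = Suc (card ?U)"
    by (simp add: card_Diff_singleton Suc_diff_le[symmetric] finite_UNIV_card_ge_0)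
  ultimately show ?thesis
    by (metis mult.right_neutral power_Suc)
qed (simp add: power_0_left)

lemma CARD_le_degree:
  fixes P :: "'a::{finite,field} poly"
  assumes "P \<noteq> 0" and "\<And>x. poly P x = 0"
  shows "CARD('a) \<le> degree P"
  using card_poly_roots_bound[OF assms(1)] assms(2) by simp

lemma CHAR_eq_of_CARD_prime_power:
  assumes "prime p" and "CARD('a::{finite,field}) = p ^ n"
  shows "CHAR('a) = p"
proof -
  \<comment> \<open>Translation by 1 permutes the field; cancelling the sum leaves the field size
    times 1.\<close>
  have "(\<Sum>x\<in>UNIV. x) = (\<Sum>x\<in>UNIV. x + 1 :: 'a)"
    by (rule sum.reindex_bij_witness[of _ "\<lambda>x. x + 1" "\<lambda>x. x - 1"]) auto
  hence "of_nat CARD('a) = (0 :: 'a)"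
    by (simp add: sum.distrib)
  hence "of_nat p = (0 :: 'a)"
    by (simp add: assms(2))
  hence "CHAR('a) dvd p"
    by (simp add: of_nat_eq_0_iff_char_dvd)
  thus ?thesis
    using assms(1) CHAR_not_1'[where 'a = 'a] by (auto simp: prime_nat_iff)
qed

text \<open>Bezout yields an exponent \<open>k\<close> with \<open>s * k\<close> congruent to 1
  modulo \<open>q - 1\<close>, so the \<open>k\<close>-th power undoes the \<open>s\<close>-th
  power. Exponents of the form \<open>(q - 1) * l + 1\<close> treat zero together with the
  units.\<close>

lemma inj_power_if_coprime:
  fixes t u :: "'a::field"
  assumes q: "q > 1" and s: "s > 0" and t: "t ^ q = t" and u: "u ^ q = u"
    and eq: "t ^ s = u ^ s" and cop: "gcd s (q - 1) = 1"
  shows "t = u"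
proof -
  obtain k l where kl: "s * k = (q - 1) * l + 1"
    using bezout_nat[of s "q - 1"] s cop by auto
  have *: "v ^ ((q - 1) * l + 1) = v" if "v ^ q = v" for v :: 'a
  proof (induction l)
    case (Suc l)
    have "(q - 1) * Suc l + 1 = (q - 1) + ((q - 1) * l + 1)"
      by simp
    hence "v ^ ((q - 1) * Suc l + 1) = v ^ (q - 1) * v"
      by (metis Suc.IH power_add)
    also have "\<dots> = v ^ q"
      using q by (metis less_imp_Suc_add diff_Suc_1 power_Suc2)
    finally show ?case using that by simp
  qed simp
  have "t = (t ^ s) ^ k"
    using *[OF t] by (simp add: kl power_mult[symmetric])
  also have "\<dots> = u"
    using *[OF u] by (simp add: eq kl power_mult[symmetric])
  finally show ?thesis .
qed

section \<open>Identities between the conjugates of \<open>a + 1/a - 2\<close>, where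
  \<open>1/a = b * c\<close>\<close>

lemma conjugates_relation:
  fixes a b c d e g :: "'a::field"
  assumes "a * b * c = 1" and "d = a + b * c - 2" "e = b + c * a - 2" "g = c + a * b - 2"
  shows "(d + e + g)\<^sup>2 - 4 * (d * e + e * g + g * d) = d * e * g"
proof -
  have "(d + e + g)\<^sup>2 - 4 * (d * e + e * g + g * d) - d * e * g
      = (1 - a * b * c) * (a\<^sup>2 + b\<^sup>2 + c\<^sup>2 + a * b * c - 4)"
    unfolding assms(2-4) by algebra
  with assms(1) show ?thesis
    by simp
qed

text \<open>Here \<open>x\<close>, \<open>y\<close>, \<open>z\<close> stand for the conjugates of
  one element. Put \<open>w = 2 * (x + y + z) + t\<close>. In the weighted sum each of
  \<open>x\<close>, \<open>y\<close>, \<open>z\<close> outside \<open>w\<close> gets the coefficient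
  \<open>2 * (d * e * g)\<close>, and \<open>w\<close> gets
  \<open>4 * (d * e + e * g + g * d) - (d + e + g)\<^sup>2\<close>, which is
  \<open>- (d * e * g)\<close> by \<open>conjugates_relation\<close>. Thus the trace cancels and
  only \<open>t\<close> survives.\<close>

lemma trace_relation:
  fixes a b c d e g :: "'a::field"
  assumes "a * b * c = 1" and "d = a + b * c - 2" "e = b + c * a - 2" "g = c + a * b - 2"
  shows "g * (d + e - g) * (2 * z + (a + b * c) * y + (c * a + b) * x + t)
       + d * (e + g - d) * (2 * x + (b + c * a) * z + (a * b + c) * y + t)
       + e * (g + d - e) * (2 * y + (c + a * b) * x + (b * c + a) * z + t) = - (d * e * g * t)"
proof -
  have args: "2 * z + (a + b * c) * y + (c * a + b) * x + t = (2 * (x + y + z) + t) + e * x + d * y"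
    "2 * x + (b + c * a) * z + (a * b + c) * y + t = (2 * (x + y + z) + t) + g * y + e * z"
    "2 * y + (c + a * b) * x + (b * c + a) * z + t = (2 * (x + y + z) + t) + d * z + g * x"
    by (simp_all add: assms(2-4) algebra_simps)
  have "g * (d + e - g) * (w + e * x + d * y) + d * (e + g - d) * (w + g * y + e * z)
      + e * (g + d - e) * (w + d * z + g * x)
    = - (d * e * g * (w - 2 * (x + y + z)))
      - ((d + e + g)\<^sup>2 - 4 * (d * e + e * g + g * d) - d * e * g) * w" for w
    by algebra
  thus ?thesis
    unfolding args conjugates_relation[OF assms] by simp
qed

text \<open>The three equations in \<open>x\<close>, \<open>y\<close>, \<open>z\<close> have
  determinant \<open>2 * (d * e * g)\<close>, which gives only \<open>2 * x = 0\<close>. The zero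
  trace adds \<open>(d + e + g) * x = 0\<close>, and \<open>rel\<close> writes
  \<open>d * e * g * x\<close> as a combination of these two, so no case split on the characteristic
  arises.\<close>

lemma linear_system_trivial:
  fixes d e g x y z :: "'a::field"
  assumes rel: "(d + e + g)\<^sup>2 - 4 * (d * e + e * g + g * d) = d * e * g" and nz: "d * e * g \<noteq> 0"
    and "e * x + d * y = 0" "g * y + e * z = 0" "d * z + g * x = 0" and "x + y + z = 0"
  shows "x = 0"
proof -
  have "e * g * (2 * x) = e * (d * z + g * x) - d * (g * y + e * z) + g * (e * x + d * y)"
    by algebra
  hence 2: "2 * x = 0"
    using nz by (simp add: assms(3-5))
  have "(d + e + g) * x = d * (x + y + z) - (e * x + d * y) - (d * z + g * x) + (e + g) * (2 * x)"
    by algebra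
  hence 1: "(d + e + g) * x = 0"
    unfolding 2 by (simp add: assms(3-6))
  have "d * e * g * x = (d + e + g) * ((d + e + g) * x) - 2 * (d * e + e * g + g * d) * (2 * x)"
    unfolding rel[symmetric] by algebra
  with nz show ?thesis
    unfolding 1 2 by simp
qed

section \<open>Frobenius and trace in a cubic extension\<close>

locale cubic_extension =
  fixes q :: nat and field_type :: "'a::{finite,field} itself"
  assumes q_gt_1: "q > 1"
    and CARD_eq: "CARD('a) = q ^ 3"
    and frob_add: "\<And>x y :: 'a. (x + y) ^ q = x ^ q + y ^ q"
begin

abbreviation tr :: "'a \<Rightarrow> 'a" where
  "tr x \<equiv> x + x ^ q + (x ^ q) ^ q"

lemma frob_cube: "((x ^ q) ^ q) ^ q = x" for x :: 'a
  using power_card_eq_self[of x] by (simp add: CARD_eq power3_eq_cube power_mult)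

lemma frob_diff: "(x - y) ^ q = x ^ q - y ^ q" for x y :: 'a
  using frob_add[of "x - y" y] by (simp add: algebra_simps)

lemma frob_2: "(2 :: 'a) ^ q = 2"
  using frob_add[of 1 1] by simp

text \<open>Membership in the subfield with \<open>q\<close> elements is expressed as being fixed by
  the \<open>q\<close>-th power.\<close>

lemma frob_tr: "tr x ^ q = tr x"
  by (simp add: frob_add frob_cube add_ac)

lemma tr_diff: "tr (x - y) = tr x - tr y"
  by (simp add: frob_diff)

lemma poly_trace_poly: "poly (trace_poly q) x = tr x" for x :: 'a
  by (simp add: trace_poly_def poly_monom power2_eq_square power_mult)

lemma degree_trace_poly: "degree (trace_poly q :: 'a poly) = q ^ 2"
proof (rule antisym)
  have "q \<le> q ^ 2" "1 \<le> q ^ 2"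
    using q_gt_1 by (auto simp: power2_eq_square)
  thus "degree (trace_poly q :: 'a poly) \<le> q ^ 2"
    unfolding trace_poly_def
    by (intro degree_add_le) (auto intro: order.trans[OF degree_monom_le])
  have "q \<noteq> q ^ 2" "1 \<noteq> q ^ 2"
    using q_gt_1 by (auto simp: power2_eq_square)
  thus "q ^ 2 \<le> degree (trace_poly q :: 'a poly)"
    by (intro le_degree) (simp add: trace_poly_def)
qed

lemma ex_tr_nonzero: "\<exists>x. tr x \<noteq> 0"
proof (rule ccontr)
  assume "\<not> ?thesis"
  hence "CARD('a) \<le> degree (trace_poly q :: 'a poly)"
    using degree_trace_poly q_gt_1 by (intro CARD_le_degree) (auto simp: poly_trace_poly)
  thus False
    using q_gt_1 by (simp add: CARD_eq degree_trace_poly power_increasing_iff)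
qed

text \<open>A root count replaces surjectivity of the trace onto the subfield: \<open>0 < k\<close>
  makes the two degrees differ, so the polynomial is nonzero, and \<open>k + 1 < q\<close> keeps its
  degree below \<open>q ^ 3\<close>.\<close>

lemma ex_tr_power_neq:
  assumes "0 < k" and "k + 1 < q"
  shows "\<exists>x. tr x ^ (k + 1) \<noteq> tr x"
proof (rule ccontr)
  let ?T = "trace_poly q :: 'a poly"
  have T0: "?T \<noteq> 0"
    using degree_trace_poly q_gt_1 by auto
  assume "\<not> ?thesis"
  hence all: "poly (?T ^ (k + 1) - ?T) x = 0" for x
    by (simp add: poly_trace_poly poly_power del: power_Suc)
  have deg: "degree (?T ^ (k + 1)) = (k + 1) * q ^ 2"
    using T0 degree_trace_poly by (subst degree_power_eq) simp_all
  have "(k + 1) * q ^ 2 \<noteq> q ^ 2"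
    using assms(1) q_gt_1 by simp
  hence "?T ^ (k + 1) - ?T \<noteq> 0"
    using deg degree_trace_poly by (metis eq_iff_diff_eq_0)
  hence "q ^ 3 \<le> degree (?T ^ (k + 1) - ?T)"
    using CARD_le_degree[OF _ all] CARD_eq by simp
  also have "\<dots> \<le> (k + 1) * q ^ 2"
    by (rule degree_diff_le) (use deg degree_trace_poly in auto)
  also have "\<dots> < q * q ^ 2"
    using assms(2) q_gt_1 by (intro mult_strict_right_mono) auto
  finally show False
    by (simp add: power3_eq_cube power2_eq_square)
qed

lemma ex_frob_neq: "\<exists>x :: 'a. x ^ q \<noteq> x"
proof (rule ccontr)
  define P :: "'a poly" where "P = monom 1 q - monom 1 1"
  assume "\<not> ?thesis"
  moreover have "coeff P q \<noteq> 0"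
    using q_gt_1 by (simp add: P_def)
  hence "P \<noteq> 0"
    by (metis coeff_0)
  ultimately have "q ^ 3 \<le> degree P"
    using CARD_le_degree[of P] by (simp add: CARD_eq P_def poly_monom)
  also have "\<dots> \<le> q"
    unfolding P_def using q_gt_1 by (intro degree_diff_le) (auto intro: order.trans[OF degree_monom_le])
  finally show False
    using q_gt_1 power_strict_increasing[of 1 3 q] by simp
qed

lemma poly_f6:
  "poly (f6 q s a) x =
     2 * (x ^ q) ^ q + (a + a ^ q * (a ^ q) ^ q) * x ^ q + ((a ^ q) ^ q * a + a ^ q) * x + tr x ^ s"
  for a x :: 'a
  by (simp add: f6_def poly_monom poly_power poly_trace_poly power_add power2_eq_square power_mult mult_ac)

section \<open>The permutation criterion\<close>

theorem permutation_poly_f6_iff: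
  fixes a :: 'a
  assumes "s > 0" and norm: "a * a ^ q * (a ^ q) ^ q = 1"
  shows "permutation_poly (f6 q s a) \<longleftrightarrow> a \<noteq> 1 \<and> gcd s (q - 1) = 1"
proof -
  let ?f = "poly (f6 q s a)"
  define b where "b = a ^ q"
  define c where "c = b ^ q"
  define d where "d = a + b * c - 2"
  define e where "e = b + c * a - 2"
  define g where "g = c + a * b - 2"
  define u where "u = g * (d + e - g)"
  have abc: "a * b * c = 1"
    using norm by (simp add: b_def c_def)
  have cq: "c ^ q = a"
    by (simp add: b_def c_def frob_cube)
  note defs = abc d_def e_def g_def
  have frob_d: "d ^ q = e" "e ^ q = g" "g ^ q = d"
    by (simp_all add: d_def e_def g_def frob_add frob_diff frob_2 power_mult_distrib cq
        flip: b_def c_def)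
  have f: "?f x = 2 * (x ^ q) ^ q + (a + b * c) * x ^ q + (c * a + b) * x + tr x ^ s" for x
    by (simp only: poly_f6 b_def c_def)
  have f': "?f x = 2 * tr x + tr x ^ s + e * x + d * x ^ q" for x
    by (simp add: f d_def e_def algebra_simps)
  have tr_f: "tr (u * ?f x) = - (d * e * g * tr x ^ s)" for x
  proof -
    have tr_pow: "(tr x ^ s) ^ q = tr x ^ s"
      by (metis frob_tr power_mult mult.commute)
    define t where "t = tr x ^ s"
    have uq: "u ^ q = d * (e + g - d)" "(u ^ q) ^ q = e * (g + d - e)"
      by (simp_all add: u_def power_mult_distrib frob_add frob_diff frob_d)
    have fq: "?f x ^ q = 2 * x + (b + c * a) * (x ^ q) ^ q + (a * b + c) * x ^ q + t"
      using tr_pow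
      by (simp only: f t_def[symmetric] frob_add frob_2 power_mult_distrib cq frob_cube
          b_def[symmetric] c_def[symmetric])
    have fqq: "(?f x ^ q) ^ q = 2 * x ^ q + (c + a * b) * x + (b * c + a) * (x ^ q) ^ q + t"
      using tr_pow
      by (simp only: fq t_def[symmetric] frob_add frob_2 power_mult_distrib cq frob_cube
          b_def[symmetric] c_def[symmetric])
    have f1: "?f x = 2 * (x ^ q) ^ q + (a + b * c) * x ^ q + (c * a + b) * x + t"
      by (simp only: f t_def)
    show ?thesis
      unfolding power_mult_distrib[of u "?f x"] power_mult_distrib[of "u ^ q" "?f x ^ q"] fqq
      unfolding uq(2) unfolding uq(1) fq
      unfolding f1 u_def t_def[symmetric]
      by (rule trace_relation[OF defs])
  qed

  show ?thesis
  proof (cases "a = 1")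
    case True
    obtain x :: 'a where "x ^ q \<noteq> x"
      using ex_frob_neq by blast
    \<comment> \<open>For \<open>a = 1\<close> both \<open>d\<close> and \<open>e\<close> vanish,
      and conjugates have the same trace.\<close>
    moreover have "?f x = ?f (x ^ q)"
      unfolding f' using True by (simp add: b_def c_def d_def e_def frob_cube add_ac)
    ultimately have "\<not> inj ?f"
      by (metis injD)
    thus ?thesis
      using True by (simp add: permutation_poly_def bij_def)
  next
    case False
    have "d = b * c * (a - 1)\<^sup>2"
      using abc unfolding d_def by algebra
    hence "d \<noteq> 0"
      using False abc by auto
    hence N: "d * e * g \<noteq> 0"
      using frob_d q_gt_1 by auto
    have "permutation_poly (f6 q s a) \<longleftrightarrow> gcd s (q - 1) = 1"
    proof
      assume cop: "gcd s (q - 1) = 1"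
      have "inj ?f"
      proof (rule injI)
        fix x y assume xy: "?f x = ?f y"
        have "tr x ^ s = tr y ^ s"
          using tr_f[of x] tr_f[of y] N by (simp add: xy)
        hence tr: "tr x = tr y"
          using inj_power_if_coprime[OF q_gt_1 \<open>s > 0\<close> frob_tr frob_tr _ cop] by blast
        define z where "z = x - y"
        have "e * x + d * x ^ q = e * y + d * y ^ q"
          using xy unfolding f' tr by simp
        hence z: "e * z + d * z ^ q = 0"
          by (simp add: z_def frob_diff algebra_simps)
        \<comment> \<open>Conjugating the equation for \<open>z\<close> twice completes the linear
          system.\<close>
        have zq: "g * z ^ q + e * (z ^ q) ^ q = 0"
          using arg_cong[OF z, of "\<lambda>v. v ^ q"] q_gt_1
          by (simp add: frob_add power_mult_distrib frob_d)
        have zqq: "d * (z ^ q) ^ q + g * z = 0"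
          using arg_cong[OF zq, of "\<lambda>v. v ^ q"] q_gt_1
          by (simp add: frob_add power_mult_distrib frob_d frob_cube)
        have "tr z = 0"
          using tr by (simp only: z_def tr_diff) simp
        from linear_system_trivial[OF conjugates_relation[OF defs] N z zq zqq this]
        show "x = y"
          by (simp add: z_def)
      qed
      thus "permutation_poly (f6 q s a)"
        by (simp add: permutation_poly_def bij_def finite_UNIV_inj_surj)
    next
      assume "permutation_poly (f6 q s a)"
      hence surj: "surj ?f"
        by (simp add: permutation_poly_def bij_def)
      obtain x0 where x0: "tr x0 \<noteq> 0"
        using ex_tr_nonzero by blast
      \<comment> \<open>As a multiple of \<open>u\<close> with nonzero trace, \<open>w0\<close> also
        shows that \<open>u\<close> is nonzero.\<close>
      define w0 where "w0 = u * ?f x0"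
      have w0: "tr w0 \<noteq> 0"
        using N x0 by (simp only: w0_def tr_f) simp
      have "u \<noteq> 0"
        using w0 q_gt_1 by (auto simp: w0_def power_0_left)
      have frob_N: "(d * e * g) ^ q = d * e * g"
        by (simp add: power_mult_distrib frob_d mult_ac)
      have ex_root: "\<exists>y. tr y ^ s = tr x" for x
      proof -
        \<comment> \<open>This scalar lies in the subfield, so it passes through the trace and gives
          \<open>k * w0\<close> the trace \<open>- (d * e * g) * tr x\<close>.\<close>
        define k where "k = - (d * e * g) * tr x / tr w0"
        have "k ^ q = k"
          unfolding k_def power_divide power_mult_distrib frob_tr frob_N[unfolded power_mult_distrib]
          using frob_diff[of 0 "d * e * g"] frob_N q_gt_1 by (simp add: power_0_left)
        obtain y where "?f y = k * w0 / u"
          using surj by (metis surjD)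
        hence "tr (u * ?f y) = tr (k * w0)"
          using \<open>u \<noteq> 0\<close> by simp
        also have "\<dots> = k * tr w0"
          using \<open>k ^ q = k\<close> by (simp add: power_mult_distrib algebra_simps)
        also have "\<dots> = - (d * e * g) * tr x"
          using w0 by (simp add: k_def)
        finally show ?thesis
          using N by (auto simp only: tr_f minus_mult_left[symmetric] neg_equal_iff_equal
              mult_cancel_left)
      qed
      show "gcd s (q - 1) = 1"
      proof (rule ccontr)
        assume ne: "gcd s (q - 1) \<noteq> 1"
        \<comment> \<open>With \<open>k = (q - 1) / r\<close>, the product \<open>s * k\<close> is a
          multiple of \<open>q - 1\<close>, so nonzero \<open>s\<close>-th powers from the subfield
          have \<open>k\<close>-th power 1.\<close>
        define r where "r = gcd s (q - 1)"
        obtain k where k: "q - 1 = r * k"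
          unfolding r_def by (meson dvdE gcd_dvd2)
        obtain j where j: "s = r * j"
          unfolding r_def by (meson dvdE gcd_dvd1)
        have "r * k \<noteq> 0"
          unfolding k[symmetric] using q_gt_1 by simp
        hence "r \<noteq> 0" "k \<noteq> 0"
          by simp_all
        moreover have "r \<noteq> 1"
          using ne by (simp add: r_def)
        ultimately have "2 \<le> r" "0 < k"
          by auto
        hence "k + 1 < q"
          using k mult_le_mono1[of 2 r k] by linarith
        have "tr x ^ (k + 1) = tr x" for x
        proof -
          obtain y where y: "tr y ^ s = tr x"
            using ex_root by blast
          define v where "v = tr y"
          have "v ^ q = v"
            unfolding v_def by (rule frob_tr)
          hence "v ^ (q - 1) * v = v"
            using q_gt_1 power_minus_mult[of q v] by simp
          hence "v = 0 \<or> v ^ (q - 1) = 1"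
            by simp
          hence "(v ^ s) ^ (k + 1) = v ^ s"
          proof
            assume "v ^ (q - 1) = 1"
            moreover have "(v ^ s) ^ k = (v ^ (q - 1)) ^ j"
              by (simp only: k j power_mult[symmetric] mult_ac)
            ultimately have "(v ^ s) ^ k = 1"
              by simp
            thus ?thesis
              by simp
          next
            assume "v = 0"
            thus ?thesis
              using \<open>s > 0\<close> by simp
          qed
          thus ?thesis
            by (simp only: v_def y)
        qed
        with ex_tr_power_neq[OF \<open>0 < k\<close> \<open>k + 1 < q\<close>] show False
          by blast
      qed
    qed
    with False show ?thesis
      by simp
  qed
qed

end

theorem theorem3p6:
  fixes p m q s :: nat
    and a :: "'a::{finite,field}"
  assumes "prime p" and "m > 0" and "q = p ^ m"
    and "CARD('a) = q ^ 3"
    and "s > 1"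
    and "a \<in> roots_of_unity (q ^ 2 + q + 1)"
  shows "permutation_poly (f6 q s a) \<longleftrightarrow> a \<noteq> 1 \<and> gcd s (q - 1) = 1"
proof -
  have "CHAR('a) = p"
    using assms(1,3,4) by (intro CHAR_eq_of_CARD_prime_power[of p "m * 3"]) (simp_all add: power_mult)
  hence add: "(x + y) ^ q = x ^ q + y ^ q" for x y :: 'a
    using assms(1,3) freshmans_dream'[where 'a = 'a] by simp
  interpret cubic_extension q "TYPE('a)"
  proof
    show "q > 1"
      using assms(1-3) prime_gt_1_nat one_less_power by blast
  qed (use assms(4) add in auto)
  \<comment> \<open>The exponent \<open>q ^ 2 + q + 1\<close> is that of the relative norm.\<close>
  have "a * a ^ q * (a ^ q) ^ q = 1"
    using assms(6)
    by (simp add: roots_of_unity_def power_add power2_eq_square power_mult mult_ac)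
  thus ?thesis
    using assms(5) by (intro permutation_poly_f6_iff) auto
qed

end
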